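(* Let $X$ be a real Banach space, let $B$ be a boundary for $X$, let $A$ be a bounded subset of $X$ and let $\varepsilon\geq 0$. If $B$ is weak*-separable (in particular, if $X$ is separable) and for each sequence $(x_n)_{n\in\mathbb{N}}$ in $A$ we have $$\bigcap_{k=1}^{\infty}\left(\overline{\operatorname{co}}^{\sigma_B}\{x_n : n\geq k\}+\varepsilon B_X\right)\neq\emptyset,$$ then $A$ is $2\varepsilon$-WRC.
   Context: $B_X$ is the closed unit ball of $X$, $X^*$ its dual and $S_{X^*}$ the unit sphere of $X^*$. A subset $B\subseteq S_{X^*}$ is a boundary for $X$ if for every $x\in X$ there is some $b\in B$ with $b(x)=\|x\|$. $B$ is weak*-separable if it has a countable subset that is dense in $B$ for the weak*-topology of $X^*$. $\sigma_B$ denotes the topology on $X$ of pointwise convergence on $B$; $\overline{\operatorname{co}}^{\sigma_B} C$ is the $\sigma_B$-closure of the convex hull of $C$. For $\delta\geq 0$, a bounded set $A\subseteq X$ is $\delta$-weakly relatively compact ($\delta$-WRC) if $\operatorname{dist}(x^{**},X)\leq\delta$ for every $x^{**}$ in the weak*-closure of $A$ in $X^{**}$ (with $X$ canonically embedded in $X^{**}$, and the distance taken in the norm of $X^{**}$). *)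

theory Defs
  imports "HOL-Analysis.Analysis"
begin

text \<open>
  The dual of \<open>'a\<close> is \<open>'a \<Rightarrow>\<^sub>L real\<close> and the bidual is \<open>('a \<Rightarrow>\<^sub>L real) \<Rightarrow>\<^sub>L real\<close>,
  both with the operator norm. On real-valued functionals the strong operator
  topology is the topology of pointwise convergence, i.e. the weak* topology.
\<close>

abbreviation weak_star_topology :: "('a::real_normed_vector \<Rightarrow>\<^sub>L real) topology"
  where "weak_star_topology \<equiv> strong_operator_topology"

definition is_boundary :: "('a::real_normed_vector \<Rightarrow>\<^sub>L real) set \<Rightarrow> bool"
  where "is_boundary B \<longleftrightarrow> B \<subseteq> sphere 0 1 \<and> (\<forall>x. \<exists>b\<in>B. blinfun_apply b x = norm x)"

definition weak_star_separable :: "('a::real_normed_vector \<Rightarrow>\<^sub>L real) set \<Rightarrow> bool"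
  where "weak_star_separable B \<longleftrightarrow> separable_space (subtopology weak_star_topology B)"

text \<open>
  The initial topology induced by the evaluation map from \<open>'a\<close> to the product of
  copies of the real line indexed by \<open>B\<close>. Elements of such a product are extensional
  functions, hence the restriction of the evaluation map to \<open>B\<close>.
\<close>

definition sigma_topology :: "('a::real_normed_vector \<Rightarrow>\<^sub>L real) set \<Rightarrow> 'a topology"
  where "sigma_topology B =
    pullback_topology UNIV (\<lambda>x. \<lambda>b\<in>B. blinfun_apply b x) (product_topology (\<lambda>_. euclideanreal) B)"

lift_definition bidual_embedding :: "'a::real_normed_vector \<Rightarrow> (('a \<Rightarrow>\<^sub>L real) \<Rightarrow>\<^sub>L real)"
  is "\<lambda>x f. blinfun_apply f x"
  by (rule blinfun.bounded_linear_left)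

definition delta_WRC :: "real \<Rightarrow> 'a::real_normed_vector set \<Rightarrow> bool"
  where "delta_WRC \<delta> A \<longleftrightarrow> bounded A \<and>
    (\<forall>z \<in> weak_star_topology closure_of (bidual_embedding ` A). infdist z (range bidual_embedding) \<le> \<delta>)"

end

theory Submission
  imports Defs "HOL-Library.Diagonal_Subsequence"
begin

text \<open>
  Fix a countable weak*-dense subset \<open>D\<close> of \<open>B\<close>; it computes the norm of the
  Banach space \<open>X\<close> as a supremum. Suppose that
  \<open>z\<close> is in the weak*-closure of \<open>A\<close> in the bidual and has distance more than \<open>2\<epsilon>\<close> from \<open>X\<close>. For each
  \<open>v \<in> X\<close> some functional of norm at most 1 separates \<open>z\<close> from \<open>v\<close> by more than \<open>2\<epsilon>\<close>. A sequence in
  \<open>A\<close> can be chosen that converges to \<open>z\<close> on \<open>D\<close> and on the functionals belonging to countably many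
  \<open>v\<close>, which are allowed to depend on the sequence: all rational combinations of its terms, and
  the vector \<open>y\<^sub>0 \<in> X\<close> that agrees with \<open>z\<close> on \<open>D\<close>, if there is one
  (lemma \<open>adapted_sequence\<close>).

  Those functionals need not lie in \<open>B\<close>, the only place where the hypothesis gives information.
  Simons' inequality (\<open>simons_convex\<close>, \<open>simons_subsequence\<close>) replaces them by members of \<open>B\<close> at the
  price of a subsequence, and a diagonal argument treats all \<open>v\<close> at once. For this subsequence
  let \<open>p = y + \<epsilon>u\<close> be a point of the intersection in the hypothesis. As \<open>p\<close> is \<open>\<epsilon>\<close>-close to the
  \<open>\<sigma>\<^sub>B\<close>-closed convex hull of every tail, it still has distance more than \<open>\<epsilon>\<close> from each of the chosen \<open>v\<close>, whereas
  it differs from \<open>z\<close> by at most \<open>\<epsilon>\<close> on \<open>D\<close>.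

  Now look at \<open>y\<close>, which lies in the \<open>\<sigma>\<^sub>B\<close>-closed convex hull of the sequence. On the
  countable set \<open>D\<close> it is a limit of convex combinations whose weights converge coordinatewise, so
  \<open>y = \<Sum> l\<^sub>m x\<^sub>m + (1 - \<Sum> l\<^sub>m) z\<close> on \<open>D\<close> (\<open>pointwise_closure_convex_hull\<close>).
  If \<open>\<Sum> l\<^sub>m = 1\<close> then \<open>y\<close> is in the closed span of the sequence, hence a limit of rational
  combinations, and \<open>p\<close> is within \<open>\<epsilon>\<close> of \<open>y\<close>: a contradiction. If \<open>\<Sum> l\<^sub>m < 1\<close> then solving for
  \<open>z\<close> exhibits a vector of \<open>X\<close> that agrees with \<open>z\<close> on \<open>D\<close>; so \<open>y\<^sub>0\<close> is such a vector, and
  \<open>p\<close> is within \<open>\<epsilon>\<close> of \<open>y\<^sub>0\<close> because \<open>D\<close> computes the norm: again a contradiction.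
\<close>

section \<open>Closures in pointwise topologies\<close>

lemma weak_star_closure_approx:
  fixes z :: "'a::real_normed_vector \<Rightarrow>\<^sub>L real"
  assumes "z \<in> weak_star_topology closure_of S" "finite F" "0 < e"
  obtains s where "s \<in> S" "\<And>f. f \<in> F \<Longrightarrow> \<bar>blinfun_apply s f - blinfun_apply z f\<bar> < e"
proof -
  let ?U = "{g. \<forall>f\<in>F. blinfun_apply g f \<in> ball (blinfun_apply z f) e}"
  have "openin weak_star_topology ?U"
    using strong_operator_topology_basis[of F "\<lambda>f. ball (blinfun_apply z f) e" "\<lambda>f. f"] assms
    by auto
  moreover have "z \<in> ?U" using assms by auto
  ultimately have "\<exists>s. s \<in> S \<and> s \<in> ?U"
    using assms(1)[unfolded in_closure_of] by (elim conjE allE[of _ ?U]) (erule mp, rule conjI)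
  then obtain s where "s \<in> S" "s \<in> ?U" by (elim exE conjE)
  then show ?thesis
    by (intro that[of s]) (auto simp: dist_real_def abs_minus_commute)
qed

lemma sigma_closure_approx:
  fixes B :: "('a::real_normed_vector \<Rightarrow>\<^sub>L real) set"
  assumes "y \<in> sigma_topology B closure_of S" "finite F" "F \<subseteq> B" "0 < e"
  obtains s where "s \<in> S" "\<And>b. b \<in> F \<Longrightarrow> \<bar>blinfun_apply b s - blinfun_apply b y\<bar> < e"
proof -
  have cont: "continuous_map (sigma_topology B) euclideanreal (blinfun_apply b)" if "b \<in> B" for b
  proof -
    have "continuous_map (sigma_topology B) euclideanreal ((\<lambda>h. h b) \<circ> (\<lambda>x. \<lambda>b\<in>B. blinfun_apply b x))"
      unfolding sigma_topology_def
      by (intro continuous_map_pullback continuous_map_product_projection that)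
    then show ?thesis using that by (simp add: o_def)
  qed
  have top: "topspace (sigma_topology B) = UNIV"
    unfolding sigma_topology_def topspace_pullback_topology by auto
  let ?U = "\<Inter>b\<in>F. {x \<in> topspace (sigma_topology B). blinfun_apply b x \<in> ball (blinfun_apply b y) e}"
  have "\<exists>s. s \<in> S \<and> (\<forall>b\<in>F. \<bar>blinfun_apply b s - blinfun_apply b y\<bar> < e)"
  proof (cases "F = {}")
    case True
    then show ?thesis using assms(1) by (metis closure_of_empty empty_iff equals0I)
  next
    case False
    have "openin (sigma_topology B) ?U"
      by (intro openin_Inter openin_INT2 openin_continuous_map_preimage[OF cont])
         (use assms False in auto)
    moreover have "y \<in> ?U" using assms by (auto simp: top)
    ultimately obtain s where "s \<in> S" "s \<in> ?U"
      using assms(1) unfolding in_closure_of by blast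
    then show ?thesis
      by (intro exI[of _ s]) (auto simp: dist_real_def abs_minus_commute)
  qed
  then show ?thesis using that by blast
qed

lemma convex_functional_halfspace:
  fixes f :: "'a::real_normed_vector \<Rightarrow>\<^sub>L real"
  shows "convex {v. c \<le> blinfun_apply f v}"
  using convex_linear_vimage[OF bounded_linear.linear[OF blinfun.bounded_linear_right[of f]], of "{c..}"]
  by (simp add: vimage_def)

lemma boundary_apply_le_norm:
  assumes "is_boundary B" "b \<in> B"
  shows "\<bar>blinfun_apply b v\<bar> \<le> norm v"
  using norm_blinfun[of b v] assms unfolding is_boundary_def by (auto simp: subset_iff)

text \<open>
  A boundary computes the norm as a maximum. Evaluation at \<open>v\<close> is weak*-continuous, so an upper
  bound on \<open>D\<close> persists on its weak*-closure.
\<close>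

lemma norm_le_if_dense:
  fixes B :: "('a::real_normed_vector \<Rightarrow>\<^sub>L real) set"
  assumes "is_boundary B" "B \<subseteq> weak_star_topology closure_of D"
    and "\<And>d. d \<in> D \<Longrightarrow> blinfun_apply d v \<le> c"
  shows "norm v \<le> c"
proof (rule field_le_epsilon)
  fix e :: real assume "0 < e"
  obtain b where b: "b \<in> B" "blinfun_apply b v = norm v"
    using assms(1) unfolding is_boundary_def by blast
  obtain d where d: "d \<in> D" "\<bar>blinfun_apply d v - blinfun_apply b v\<bar> < e"
  proof (rule weak_star_closure_approx[of b D "{v}" e])
    show "b \<in> weak_star_topology closure_of D" using assms(2) b(1) by auto
  qed (use \<open>0 < e\<close> in auto)
  show "norm v \<le> c + e" using assms(3)[OF d(1)] d(2) b(2) by linarith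
qed

text \<open>
  On a bounded set of functionals, pointwise convergence on a dense sequence of vectors already
  implies weak* convergence. Evaluation along such a sequence therefore embeds \<open>B\<close> into the space
  of real sequences, where every subset has a countable dense subset.
\<close>

lemma separable_imp_weak_star_separable:
  fixes B :: "('a::real_normed_vector \<Rightarrow>\<^sub>L real) set"
  assumes "separable_space (euclidean :: 'a topology)" "bounded B"
  shows "weak_star_separable B"
proof -
  obtain E :: "'a set" where E: "countable E" "closure E = UNIV"
    using assms(1) unfolding separable_space_def by auto
  then have "E \<noteq> {}" by auto
  define e where "e = from_nat_into E"
  have range_e: "range e = E" using range_from_nat_into[OF \<open>E \<noteq> {}\<close> E(1)] by (simp add: e_def)
  obtain M where M: "\<And>b. b \<in> B \<Longrightarrow> norm b \<le> M" using assms(2) unfolding bounded_iff by blast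
  define \<Phi> where "\<Phi> b = (\<lambda>n. blinfun_apply b (e n))" for b :: "'a \<Rightarrow>\<^sub>L real"
  \<comment> \<open>Subsets of the second countable space \<open>nat \<Rightarrow> real\<close> are separable.\<close>
  obtain T where T: "countable T" "T \<subseteq> \<Phi> ` B" "\<Phi> ` B \<subseteq> closure T" by (rule separable)
  define C where "C = inv_into B \<Phi> ` T"
  have C: "countable C" "C \<subseteq> B" "\<Phi> ` C = T"
    using T(1,2) inv_into_into[of _ \<Phi> B] f_inv_into_f[of _ \<Phi> B]
    unfolding C_def by (auto simp: subset_iff image_image)
  have "b \<in> weak_star_topology closure_of C" if b: "b \<in> B" for b
  proof -
    have "\<Phi> b \<in> closure (\<Phi> ` C)" using T(3) b C(3) by auto
    then obtain w where w: "\<And>n. w n \<in> \<Phi> ` C" "w \<longlonglongrightarrow> \<Phi> b"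
      unfolding closure_sequential by blast
    have "\<exists>a. a \<in> C \<and> w n = \<Phi> a" for n using w(1)[of n] by blast
    then obtain c where c: "\<And>n. c n \<in> C" "\<And>n. w n = \<Phi> (c n)" by metis
    have conv_e: "(\<lambda>n. blinfun_apply (c n) (e k)) \<longlonglongrightarrow> blinfun_apply b (e k)" for k
    proof -
      have "((\<lambda>h. h k) \<circ> w) \<longlonglongrightarrow> \<Phi> b k"
        using continuous_on_tendsto_compose[OF continuous_on_product_coordinates w(2)]
        by (simp add: o_def)
      then show ?thesis by (simp add: o_def c(2) \<Phi>_def)
    qed
    have conv: "(\<lambda>n. blinfun_apply (c n) x) \<longlonglongrightarrow> blinfun_apply b x" for x
    proof (rule LIMSEQ_I)
      fix \<eta> :: real assume "0 < \<eta>"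
      have "M \<ge> 0" using M[OF b] norm_ge_zero order_trans by blast
      have "x \<in> closure E" by (simp add: E(2))
      moreover have "0 < \<eta> / (3 * (M + 1))" using \<open>M \<ge> 0\<close> \<open>0 < \<eta>\<close> by simp
      ultimately obtain k where k: "dist (e k) x < \<eta> / (3 * (M + 1))"
        unfolding closure_approachable range_e[symmetric] by blast
      have close: "\<bar>blinfun_apply a (e k) - blinfun_apply a x\<bar> < \<eta> / 3" if "a \<in> B" for a
      proof -
        have "\<bar>blinfun_apply a (e k) - blinfun_apply a x\<bar> \<le> norm a * norm (e k - x)"
          using norm_blinfun[of a "e k - x"] by (simp add: blinfun.diff_right)
        also have "\<dots> \<le> (M + 1) * norm (e k - x)"
          using M[OF that] by (intro mult_right_mono) auto
        also have "\<dots> < \<eta> / 3"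
          using k \<open>M \<ge> 0\<close> by (simp add: dist_norm field_simps)
        finally show ?thesis .
      qed
      obtain N where N: "\<And>n. n \<ge> N \<Longrightarrow>
          norm (blinfun_apply (c n) (e k) - blinfun_apply b (e k)) < \<eta> / 3"
        using LIMSEQ_D[OF conv_e, of "\<eta> / 3" k] \<open>0 < \<eta>\<close> by auto
      have "norm (blinfun_apply (c n) x - blinfun_apply b x) < \<eta>" if "n \<ge> N" for n
      proof -
        have "c n \<in> B" using c(1) C(2) by blast
        then show ?thesis using N[OF that] close[OF b] close[of "c n"] unfolding real_norm_def by linarith
      qed
      then show "\<exists>N. \<forall>n\<ge>N. norm (blinfun_apply (c n) x - blinfun_apply b x) < \<eta>" by blast
    qed
    have "limitin euclidean (\<lambda>n. blinfun_apply (c n)) (blinfun_apply b) sequentially"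
      using conv unfolding euclidean_product_topology[symmetric] limitin_componentwise by simp
    then have lim: "(\<lambda>n. blinfun_apply (c n)) \<longlonglongrightarrow> blinfun_apply b" by simp
    show ?thesis
      unfolding in_closure_of strong_operator_topology_topspace
    proof (intro conjI allI impI UNIV_I)
      fix U assume U: "b \<in> U \<and> openin weak_star_topology U"
      then obtain W where W: "open W" "U = blinfun_apply -` W"
        unfolding strong_operator_topology_def openin_pullback_topology by auto
      then have "\<forall>\<^sub>F n in sequentially. blinfun_apply (c n) \<in> W"
        using topological_tendstoD[OF lim] U by auto
      then obtain n where "blinfun_apply (c n) \<in> W" unfolding eventually_sequentially by blast
      then show "\<exists>y. y \<in> C \<and> y \<in> U" using c(1) W(2) by blast
    qed
  qed
  then have "B \<subseteq> weak_star_topology closure_of C" by blast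
  then show ?thesis
    unfolding weak_star_separable_def separable_space_def
    using C(1,2) by (intro exI[of _ C])
      (auto simp: closure_of_subtopology strong_operator_topology_topspace Int_absorb1)
qed

section \<open>Simons' inequality\<close>

text \<open>
  Simons' argument. One builds \<open>u = (\<Sum>n. (1/2)^(n+1) *\<^sub>R g n)\<close> with each \<open>g n \<in> C n\<close> an
  almost optimal choice for keeping the norm of \<open>u\<close> small, given the earlier ones. A functional
  \<open>b\<close> in the boundary with \<open>b u = norm u\<close> then cannot be much smaller on a remainder of the series
  than on \<open>u\<close>, for otherwise it would reveal a better choice. Since the
  remainders, rescaled, are limits of members of \<open>C n\<close>, the same \<open>b\<close> is almost \<open>c\<close> or more somewhere on every \<open>C n\<close>.
\<close>

lemma simons_convex:
  fixes C :: "nat \<Rightarrow> 'a::banach set"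
  assumes B: "is_boundary B"
    and C: "\<And>n. convex (C n)" "\<And>n. C n \<noteq> {}" "decseq C"
    and bdd: "bounded (C 0)" and c: "\<And>g. g \<in> C 0 \<Longrightarrow> c \<le> norm g" and "0 < \<delta>"
  obtains b where "b \<in> B" "\<And>n. \<exists>g\<in>C n. c - \<delta> < blinfun_apply b g"
proof -
  define U where "U f n = (\<Sum>i<n. (1/2)^Suc i *\<^sub>R f i)" for f :: "nat \<Rightarrow> 'a" and n
  \<comment> \<open>The error made at stage \<open>n\<close> is magnified by \<open>2^n\<close> in \<open>step\<close> below.\<close>
  define e where "e n = \<delta> / 4 * (1/4)^n" for n :: nat
  have e_pos: "e n > 0" for n using \<open>0 < \<delta>\<close> by (simp add: e_def)
  \<comment> \<open>Near-minimality of \<open>g n\<close> makes \<open>norm (U g n + (1/2)^n *\<^sub>R g n)\<close> at most \<open>norm u + e n\<close>,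
    because the rest of the series for \<open>u\<close> is \<open>(1/2)^n\<close> times a limit of members of \<open>C n\<close>.\<close>
  have "\<exists>g. \<forall>n. g n \<in> C n \<and>
    (\<forall>h\<in>C n. norm (U g n + (1/2)^n *\<^sub>R g n) \<le> norm (U g n + (1/2)^n *\<^sub>R h) + e n)"
  proof (rule dependent_wellorder_choice)
    fix r :: 'a and f g :: "nat \<Rightarrow> 'a" and n :: nat
    assume "\<And>i. i < n \<Longrightarrow> f i = g i"
    then have "U f n = U g n" unfolding U_def by (intro sum.cong) auto
    then show "(r \<in> C n \<and> (\<forall>h\<in>C n. norm (U f n + (1/2)^n *\<^sub>R r) \<le> norm (U f n + (1/2)^n *\<^sub>R h) + e n)) =
      (r \<in> C n \<and> (\<forall>h\<in>C n. norm (U g n + (1/2)^n *\<^sub>R r) \<le> norm (U g n + (1/2)^n *\<^sub>R h) + e n))"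
      by simp
  next
    fix n and f :: "nat \<Rightarrow> 'a"
    let ?N = "(\<lambda>h. norm (U f n + (1/2)^n *\<^sub>R h)) ` C n"
    have "Inf ?N < Inf ?N + e n" using e_pos by simp
    then obtain r where r: "r \<in> C n" "norm (U f n + (1/2)^n *\<^sub>R r) < Inf ?N + e n"
      using C(2)[of n] cInf_lessD[of ?N] by blast
    have "Inf ?N \<le> norm (U f n + (1/2)^n *\<^sub>R h)" if "h \<in> C n" for h
      by (rule cInf_lower) (use that in \<open>auto intro!: bdd_belowI[of _ 0]\<close>)
    with r show "\<exists>r. r \<in> C n \<and> (\<forall>h\<in>C n. norm (U f n + (1/2)^n *\<^sub>R r) \<le> norm (U f n + (1/2)^n *\<^sub>R h) + e n)"
      by (intro exI[of _ r]) force
  qed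
  then obtain g where gC: "\<And>n. g n \<in> C n"
    and gmin: "\<And>n h. h \<in> C n \<Longrightarrow> norm (U g n + (1/2)^n *\<^sub>R g n) \<le> norm (U g n + (1/2)^n *\<^sub>R h) + e n"
    by blast
  have sub: "C n \<subseteq> C m" if "m \<le> n" for m n using C(3) that by (auto simp: decseq_def)
  obtain M where M: "\<And>h. h \<in> C 0 \<Longrightarrow> norm h \<le> M" using bdd unfolding bounded_iff by blast
  have "summable (\<lambda>i. (1/2)^Suc i *\<^sub>R g i)"
  proof (rule summable_comparison_test')
    show "summable (\<lambda>i. M * (1/2)^Suc i)"
      by (intro summable_mult) (simp add: summable_Suc_iff summable_geometric del: power_Suc)
    show "norm ((1/2)^Suc i *\<^sub>R g i) \<le> M * (1/2)^Suc i" if "i \<ge> 0" for i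
      using M[of "g i"] gC[of i] sub[of 0 i] by (auto simp: mult_right_mono)
  qed
  define u where "u = (\<Sum>i. (1/2)^Suc i *\<^sub>R g i)"
  have lim: "U g \<longlonglongrightarrow> u"
    using summable_LIMSEQ[OF \<open>summable _\<close>] unfolding U_def u_def by simp
  define t where "t n = 2^n *\<^sub>R (u - U g n)" for n
  have in_C: "2^n *\<^sub>R (U g (n+k) - U g n) + (1/2)^k *\<^sub>R h \<in> C n" if "h \<in> C n" for n k h
    using that
  proof (induction k arbitrary: h)
    case (Suc k)
    have "g (n+k) \<in> C n" using gC[of "n+k"] sub[of n "n+k"] by auto
    then have "(1/2) *\<^sub>R g (n+k) + (1/2) *\<^sub>R h \<in> C n"
      using C(1)[of n] Suc.prems by (intro convexD) auto
    note Suc.IH[OF this]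
    also have "2^n *\<^sub>R (U g (n+k) - U g n) + (1/2)^k *\<^sub>R ((1/2) *\<^sub>R g (n+k) + (1/2) *\<^sub>R h)
      = 2^n *\<^sub>R (U g (n + Suc k) - U g n) + (1/2)^Suc k *\<^sub>R h"
    proof -
      have "(2::real)^n * (1/2)^Suc (n+k) = (1/2)^k * (1/2)"
        by (simp add: power_add power_one_over)
      then show ?thesis
        by (simp add: U_def scaleR_right_distrib scaleR_right_diff_distrib del: power_Suc)
           (simp add: algebra_simps)
    qed
    finally show ?case .
  qed simp
  have t_closure: "t n \<in> closure (C n)" for n
  proof -
    obtain h where "h \<in> C n" using C(2) by blast
    have "(\<lambda>k. 2^n *\<^sub>R (U g (n+k) - U g n) + (1/2)^k *\<^sub>R h) \<longlonglongrightarrow> 2^n *\<^sub>R (u - U g n) + 0 *\<^sub>R h"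
      by (intro tendsto_intros LIMSEQ_ignore_initial_segment[OF lim, of n, unfolded add.commute[of _ n]]
          LIMSEQ_power_zero) simp
    then show ?thesis
      unfolding t_def closure_sequential
      by (intro exI[of _ "\<lambda>k. 2^n *\<^sub>R (U g (n+k) - U g n) + (1/2)^k *\<^sub>R h"] conjI allI)
         (use in_C[OF \<open>h \<in> C n\<close>] in simp_all)
  qed
  have u_t: "u = U g n + (1/2)^n *\<^sub>R t n" for n
    by (simp add: t_def power_one_over field_simps)
  have norm_u: "norm (U g n + (1/2)^n *\<^sub>R g n) \<le> norm u + e n" for n
  proof -
    have "closure (C n) \<subseteq> {h. norm (U g n + (1/2)^n *\<^sub>R g n) \<le> norm (U g n + (1/2)^n *\<^sub>R h) + e n}"
      by (intro closure_minimal closed_Collect_le continuous_intros) (use gmin in auto)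
    then show ?thesis using t_closure[of n] u_t[of n] by auto
  qed
  obtain b where b: "b \<in> B" "blinfun_apply b u = norm u" using B unfolding is_boundary_def by blast
  have b1: "blinfun_apply b v \<le> norm v" for v
    using boundary_apply_le_norm[OF B b(1), of v] by simp
  \<comment> \<open>\<open>2 *\<^sub>R U g (Suc n) - U g n\<close> is the vector controlled by \<open>norm_u\<close>; comparing it with \<open>u\<close>, at
    which \<open>b\<close> attains the norm, shows that \<open>b\<close> can hardly decrease from one remainder to the next.\<close>
  have step: "blinfun_apply b (t n) - \<delta> / 4 * (1/2)^n \<le> blinfun_apply b (t (Suc n))" for n
  proof -
    have "U g n + (1/2)^n *\<^sub>R g n = 2 *\<^sub>R U g (Suc n) - U g n"
      by (simp add: U_def scaleR_2 algebra_simps flip: scaleR_add_left)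
    then have "2 * blinfun_apply b (U g (Suc n)) - blinfun_apply b (U g n) \<le> blinfun_apply b u + e n"
      using b1[of "U g n + (1/2)^n *\<^sub>R g n"] norm_u[of n] b(2)
      by (simp add: blinfun.diff_right blinfun.scaleR_right)
    moreover have "blinfun_apply b (U g n) = blinfun_apply b u - (1/2)^n * blinfun_apply b (t n)" for n
      using arg_cong[OF u_t[of n], of "blinfun_apply b"]
      by (simp add: blinfun.add_right blinfun.scaleR_right)
    ultimately have "(1/2)^n * (blinfun_apply b (t n) - blinfun_apply b (t (Suc n))) \<le> e n"
      by (simp add: algebra_simps)
    also have "e n = (1/2)^n * (\<delta> / 4 * (1/2)^n)"
      by (simp add: e_def flip: power_mult_distrib)
    finally show ?thesis by (simp only: mult_le_cancel_left) simp
  qed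
  have tail: "c - \<delta> / 2 * (1 - (1/2)^n) \<le> blinfun_apply b (t n)" for n
  proof (induction n)
    case 0
    have "closure (C 0) \<subseteq> {g. c \<le> norm g}"
      by (intro closure_minimal closed_Collect_le continuous_intros) (use c in auto)
    then have "c \<le> norm u" using t_closure[of 0] by (auto simp: t_def U_def)
    then show ?case using b(2) by (simp add: t_def U_def)
  next
    case (Suc n)
    then show ?case using step[of n] by (simp add: algebra_simps)
  qed
  have "\<exists>g\<in>C n. c - \<delta> < blinfun_apply b g" for n
  proof (rule ccontr)
    assume "\<not> ?thesis"
    then have "closure (C n) \<subseteq> {g. blinfun_apply b g \<le> c - \<delta>}"
      by (intro closure_minimal closed_Collect_le continuous_intros) auto
    then have "blinfun_apply b (t n) \<le> c - \<delta>" using t_closure[of n] by auto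
    moreover have "\<delta> / 2 * (1 - (1/2)^n) < \<delta>"
      using \<open>0 < \<delta>\<close> by (auto simp: field_simps intro: add_strict_increasing)
    ultimately show False using tail[of n] by linarith
  qed
  with b(1) show ?thesis using that by blast
qed

text \<open>
  The lower bound \<open>c\<close> for \<open>f\<close> passes to the convex hulls of the tails of \<open>x\<close>, hence to the norm there,
  and Simons' inequality applies to these hulls. The functional \<open>b\<close> can only be large on the hull of a
  tail if it is large at some term of that tail.
\<close>

lemma simons_subsequence:
  fixes x :: "nat \<Rightarrow> 'a::banach"
  assumes "is_boundary B" "bounded (range x)" "norm f \<le> 1"
    and c: "\<And>n. c \<le> blinfun_apply f (x n)" and "c' < c"
  obtains b and r :: "nat \<Rightarrow> nat" where "b \<in> B" "strict_mono r" "\<And>n. c' < blinfun_apply b (x (r n))"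
proof -
  define C where "C n = convex hull (x ` {n..})" for n
  have low: "c \<le> norm g" if "g \<in> C 0" for g
  proof -
    have "C 0 \<subseteq> {v. c \<le> blinfun_apply f v}"
      unfolding C_def by (rule hull_minimal) (use c convex_functional_halfspace in auto)
    moreover have "blinfun_apply f g \<le> norm g"
      using norm_blinfun[of f g] mult_right_mono[OF assms(3), of "norm g"] by simp
    ultimately show ?thesis using that by auto
  qed
  have "bounded (C 0)"
    unfolding C_def by (rule bounded_convex_hull) (use assms(2) in \<open>auto intro: bounded_subset\<close>)
  moreover have "decseq C"
    unfolding C_def decseq_def by (intro allI impI hull_mono image_mono) auto
  ultimately obtain b where b: "b \<in> B" "\<And>n. \<exists>g\<in>C n. c - (c - c') < blinfun_apply b g"
    using simons_convex[OF assms(1), of C c "c - c'"] low \<open>c' < c\<close> by (auto simp: C_def)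
  have "\<exists>m\<ge>n. c' < blinfun_apply b (x m)" for n
  proof (rule ccontr)
    assume "\<not> ?thesis"
    then have "C n \<subseteq> {v. - c' \<le> blinfun_apply (- b) v}"
      unfolding C_def by (intro hull_minimal convex_functional_halfspace) (auto simp: not_less blinfun.minus_left)
    with b(2)[of n] show False by (force simp: blinfun.minus_left)
  qed
  then have "infinite {m. c' < blinfun_apply b (x m)}"
    unfolding infinite_nat_iff_unbounded_le by blast
  from infinite_enumerate[OF this] obtain r :: "nat \<Rightarrow> nat"
    where r: "strict_mono r" "\<forall>n. r n \<in> {m. c' < blinfun_apply b (x m)}" by (elim exE conjE)
  show ?thesis by (rule that[OF b(1) r(1)]) (use r(2) in simp)
qed

section \<open>Sequences adapted to a point of the bidual\<close>

text \<open>
  Any functional at which \<open>z - v\<close> comes close enough to its norm will do.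
\<close>

lemma norming_functional_far:
  fixes z :: "('a::real_normed_vector \<Rightarrow>\<^sub>L real) \<Rightarrow>\<^sub>L real"
  assumes "0 \<le> s" "s < infdist z (range bidual_embedding)"
  obtains f where "norm f \<le> 1" "s < blinfun_apply z f - blinfun_apply f v"
proof -
  let ?w = "z - bidual_embedding v"
  have "s < norm ?w"
    using infdist_le[of "bidual_embedding v" "range bidual_embedding" z] assms(2)
    by (simp add: dist_norm)
  then have "\<not> (\<forall>g. norm (blinfun_apply ?w g) \<le> s * norm g)"
    using norm_blinfun_bound[OF assms(1), of ?w] by auto
  then obtain g where g: "s * norm g < \<bar>blinfun_apply ?w g\<bar>"
    by (auto simp: not_le)
  then have "0 < norm g" using assms(1) by auto
  define f where "f = (sgn (blinfun_apply ?w g) / norm g) *\<^sub>R g"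
  have "norm f \<le> 1" using \<open>0 < norm g\<close> by (simp add: f_def abs_sgn_eq)
  moreover have "blinfun_apply ?w f = \<bar>blinfun_apply ?w g\<bar> / norm g"
    by (simp add: f_def blinfun.scaleR_right abs_sgn mult.commute)
  then have "s < blinfun_apply ?w f" using g \<open>0 < norm g\<close> by (simp add: pos_less_divide_eq)
  ultimately show ?thesis using that by (simp add: blinfun.diff_left bidual_embedding.rep_eq)
qed

text \<open>
  Weak*-closeness to \<open>z\<close> can be requested for finitely many functionals at a time, so a sequence
  can be built that converges to \<open>z\<close> on countably many functionals, the \<open>n\<close>-th of which may be
  chosen in response to the terms before \<open>n\<close>.
\<close>

lemma adapted_sequence:
  fixes z :: "('a::real_normed_vector \<Rightarrow>\<^sub>L real) \<Rightarrow>\<^sub>L real"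
    and G :: "(nat \<Rightarrow> 'a) \<Rightarrow> nat \<Rightarrow> ('a \<Rightarrow>\<^sub>L real)"
  assumes z: "z \<in> weak_star_topology closure_of (bidual_embedding ` A)"
    and local: "\<And>x x' n. (\<And>i. i < n \<Longrightarrow> x i = x' i) \<Longrightarrow> G x n = G x' n"
  obtains x where "range x \<subseteq> A" "\<And>n. (\<lambda>m. blinfun_apply (G x n) (x m)) \<longlonglongrightarrow> blinfun_apply z (G x n)"
proof -
  have "\<exists>x. \<forall>n. x n \<in> A \<and>
    (\<forall>j\<le>n. \<bar>blinfun_apply (G x j) (x n) - blinfun_apply z (G x j)\<bar> < 1 / Suc n)"
  proof (rule dependent_wellorder_choice)
    fix r :: 'a and x x' :: "nat \<Rightarrow> 'a" and n :: nat
    assume "\<And>i. i < n \<Longrightarrow> x i = x' i"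
    then have "G x j = G x' j" if "j \<le> n" for j using that by (intro local) auto
    then show "(r \<in> A \<and> (\<forall>j\<le>n. \<bar>blinfun_apply (G x j) r - blinfun_apply z (G x j)\<bar> < 1 / Suc n)) =
      (r \<in> A \<and> (\<forall>j\<le>n. \<bar>blinfun_apply (G x' j) r - blinfun_apply z (G x' j)\<bar> < 1 / Suc n))"
      by auto
  next
    fix n and x :: "nat \<Rightarrow> 'a"
    obtain s where "s \<in> bidual_embedding ` A"
      "\<And>f. f \<in> G x ` {..n} \<Longrightarrow> \<bar>blinfun_apply s f - blinfun_apply z f\<bar> < 1 / Suc n"
      using weak_star_closure_approx[OF z, of "G x ` {..n}" "1 / Suc n"] by auto
    then show "\<exists>r. r \<in> A \<and> (\<forall>j\<le>n. \<bar>blinfun_apply (G x j) r - blinfun_apply z (G x j)\<bar> < 1 / Suc n)"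
      by (auto simp: bidual_embedding.rep_eq)
  qed
  then obtain x where x: "\<And>n. x n \<in> A"
    "\<And>j n. j \<le> n \<Longrightarrow> \<bar>blinfun_apply (G x j) (x n) - blinfun_apply z (G x j)\<bar> < 1 / Suc n"
    by blast
  have "(\<lambda>m. blinfun_apply (G x n) (x m)) \<longlonglongrightarrow> blinfun_apply z (G x n)" for n
  proof (rule LIM_zero_cancel, rule Lim_null_comparison[OF _ LIMSEQ_Suc[OF lim_1_over_n]])
    show "\<forall>\<^sub>F m in sequentially.
      norm (blinfun_apply (G x n) (x m) - blinfun_apply z (G x n)) \<le> 1 / real (Suc m)"
      using eventually_ge_at_top[of n] by eventually_elim (use x(2) in \<open>auto intro: less_imp_le\<close>)
  qed
  with x(1) show ?thesis using that by blast
qed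

text \<open>
  Only a tail of the diagonal sequence is a subsequence of the \<open>n\<close>-th extracted sequence, hence
  the shift by \<open>k\<close>.
\<close>

lemma diagonal_subsequence:
  fixes P :: "nat \<Rightarrow> (nat \<Rightarrow> nat) \<Rightarrow> bool"
  assumes "\<And>n (s :: nat \<Rightarrow> nat). strict_mono s \<Longrightarrow> \<exists>r :: nat \<Rightarrow> nat. strict_mono r \<and> P n (s \<circ> r)"
    and "\<And>(r :: nat \<Rightarrow> nat) s n. strict_mono r \<Longrightarrow> P n s \<Longrightarrow> P n (s \<circ> r)"
  obtains s where "strict_mono s" "\<And>n. \<exists>k. P n (s \<circ> (+) k)"
proof -
  interpret subseqs P
  proof
    show "\<exists>r'. strict_mono r' \<and> P n (s \<circ> r')" if "strict_mono s" for n and s :: "nat \<Rightarrow> nat"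
      using assms(1)[OF that] .
  qed
  show ?thesis
  proof
    show "strict_mono diagseq" by (rule subseq_diagseq)
    show "\<exists>k. P n (diagseq \<circ> (+) k)" for n
      using diagseq_holds[of n, OF assms(2)] by (rule exI)
  qed
qed

section \<open>Limits of convex combinations\<close>

lemma convex_hull_range_weights:
  fixes x :: "nat \<Rightarrow> 'a::real_normed_vector"
  assumes "y \<in> convex hull (range x)"
  obtains w where "\<And>m. 0 \<le> w m" "w sums 1" "(\<lambda>m. w m *\<^sub>R x m) sums y"
proof -
  \<comment> \<open>Admitting infinite convex combinations makes convexity a matter of adding two series.\<close>
  let ?T = "{y. \<exists>w. (\<forall>m. 0 \<le> w m) \<and> w sums 1 \<and> (\<lambda>m. w m *\<^sub>R x m) sums y}"
  have "convex ?T"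
  proof (rule convexI)
    fix y y' and a b :: real
    assume ab: "0 \<le> a" "0 \<le> b" "a + b = 1" and "y \<in> ?T" "y' \<in> ?T"
    then obtain w w' where w: "\<forall>m. 0 \<le> w m" "w sums 1" "(\<lambda>m. w m *\<^sub>R x m) sums y"
      and w': "\<forall>m. 0 \<le> w' m" "w' sums 1" "(\<lambda>m. w' m *\<^sub>R x m) sums y'" by auto
    have "(\<lambda>m. a * w m + b * w' m) sums 1"
      using sums_add[OF sums_mult[OF w(2), of a] sums_mult[OF w'(2), of b]] ab by simp
    moreover have "(\<lambda>m. (a * w m + b * w' m) *\<^sub>R x m) sums (a *\<^sub>R y + b *\<^sub>R y')"
      using sums_add[OF sums_scaleR_right[OF w(3), of a] sums_scaleR_right[OF w'(3), of b]]
      by (simp add: scaleR_left_distrib)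
    ultimately show "a *\<^sub>R y + b *\<^sub>R y' \<in> ?T"
      using w(1) w'(1) ab by (auto intro!: exI[of _ "\<lambda>m. a * w m + b * w' m"])
  qed
  moreover have "range x \<subseteq> ?T"
  proof safe
    fix n
    show "\<exists>w. (\<forall>m. 0 \<le> w m) \<and> w sums 1 \<and> (\<lambda>m. w m *\<^sub>R x m) sums x n"
    proof (intro exI conjI)
      show "(\<lambda>m. if m = n then 1 else 0 :: real) sums 1" by (rule sums_single)
      have "(\<lambda>m. (if m = n then 1 else 0 :: real) *\<^sub>R x m) = (\<lambda>m. if m = n then x m else 0)" by auto
      then show "(\<lambda>m. (if m = n then 1 else 0 :: real) *\<^sub>R x m) sums x n"
        using sums_single[of n x] by simp
    qed auto
  qed
  ultimately have "convex hull (range x) \<subseteq> ?T" by (rule hull_minimal[rotated])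
  with assms have "y \<in> ?T" by (rule rev_subsetD)
  then show ?thesis using that by auto
qed

lemma weighted_tail_le:
  fixes v a :: "nat \<Rightarrow> real"
  assumes v: "\<And>m. 0 \<le> v m" "summable v" "suminf v \<le> 1"
    and a: "Bseq a" "\<And>m. m \<ge> M \<Longrightarrow> \<bar>a m\<bar> \<le> e"
  shows "\<bar>(\<Sum>m. v m * a m) - (\<Sum>m<M. v m * a m)\<bar> \<le> e"
proof -
  obtain K where K: "\<And>m. \<bar>a m\<bar> \<le> K" using a(1) unfolding Bseq_def by auto
  have "summable (\<lambda>m. v m * a m)"
  proof (rule summable_comparison_test')
    show "summable (\<lambda>m. v m * K)" by (rule summable_mult2[OF v(2)])
    show "norm (v m * a m) \<le> v m * K" if "m \<ge> 0" for m
      using mult_left_mono[OF K v(1)] v(1) by (simp add: abs_mult)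
  qed
  then have "(\<Sum>m. v m * a m) - (\<Sum>m<M. v m * a m) = (\<Sum>m. v (m + M) * a (m + M))"
    by (rule suminf_minus_initial_segment[symmetric])
  also have "\<bar>\<dots>\<bar> \<le> (\<Sum>m. v (m + M) * e)"
    unfolding real_norm_def[symmetric]
  proof (rule norm_suminf_le)
    show "summable (\<lambda>m. v (m + M) * e)"
      by (intro summable_mult2 summable_ignore_initial_segment v)
    show "norm (v (m + M) * a (m + M)) \<le> v (m + M) * e" for m
      using mult_left_mono[OF a(2)[of "m + M"] v(1)] v(1) by (simp add: abs_mult)
  qed
  also have "\<dots> = (\<Sum>m. v (m + M)) * e"
    by (rule suminf_mult2[symmetric]) (intro summable_ignore_initial_segment v)
  also have "\<dots> \<le> 1 * e"
  proof (rule mult_right_mono)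
    show "(\<Sum>m. v (m + M)) \<le> 1"
      using suminf_split_initial_segment[OF v(2), of M] v(1,3) sum_nonneg[of "{..<M}" v] by simp
    show "0 \<le> e" using a(2)[of M] by linarith
  qed
  finally show ?thesis by simp
qed

text \<open>
  Weights may lose mass in a coordinatewise limit, but the lost mass escapes to infinity, where
  \<open>a\<close> vanishes.
\<close>

lemma weighted_limit:
  fixes w :: "nat \<Rightarrow> nat \<Rightarrow> real"
  assumes w: "\<And>n m. 0 \<le> w n m" "\<And>n. w n sums 1" "\<And>m. (\<lambda>n. w n m) \<longlonglongrightarrow> l m"
  shows "\<And>m. 0 \<le> l m" "summable l" "suminf l \<le> 1"
    and "\<And>a. a \<longlonglongrightarrow> 0 \<Longrightarrow> (\<lambda>n. \<Sum>m. w n m * a m) \<longlonglongrightarrow> (\<Sum>m. l m * a m)"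
proof -
  show l0: "0 \<le> l m" for m by (rule LIMSEQ_le_const[OF w(3)]) (use w(1) in auto)
  have part: "(\<Sum>m<M. l m) \<le> 1" for M
  proof (rule LIMSEQ_le_const2)
    show "(\<lambda>n. \<Sum>m<M. w n m) \<longlonglongrightarrow> (\<Sum>m<M. l m)" by (intro tendsto_sum w(3))
    show "\<exists>N. \<forall>n\<ge>N. (\<Sum>m<M. w n m) \<le> 1"
      using sum_le_suminf[OF sums_summable[OF w(2)], of "{..<M}"] sums_unique[OF w(2)] w(1) by auto
  qed
  show sl: "summable l" by (rule summableI_nonneg_bounded[OF l0 part])
  show l1: "suminf l \<le> 1" by (rule suminf_le_const[OF sl part])
  fix a :: "nat \<Rightarrow> real" assume a: "a \<longlonglongrightarrow> 0"
  show "(\<lambda>n. \<Sum>m. w n m * a m) \<longlonglongrightarrow> (\<Sum>m. l m * a m)"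
  proof (rule LIMSEQ_I)
    fix e :: real assume "0 < e"
    obtain M where M: "\<And>m. m \<ge> M \<Longrightarrow> \<bar>a m\<bar> \<le> e / 4"
      using LIMSEQ_D[OF a, of "e / 4"] \<open>0 < e\<close> by (auto intro: less_imp_le)
    have "Bseq a" using a by (intro convergent_imp_Bseq) (auto simp: convergent_def)
    note tail = weighted_tail_le[OF _ _ _ this M]
    have "(\<lambda>n. \<Sum>m<M. w n m * a m) \<longlonglongrightarrow> (\<Sum>m<M. l m * a m)" by (intro tendsto_intros w(3))
    from LIMSEQ_D[OF this, of "e / 4"] obtain N where
      N: "\<And>n. n \<ge> N \<Longrightarrow> \<bar>(\<Sum>m<M. w n m * a m) - (\<Sum>m<M. l m * a m)\<bar> < e / 4"
      using \<open>0 < e\<close> by auto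
    have w_tail: "\<bar>(\<Sum>m. w n m * a m) - (\<Sum>m<M. w n m * a m)\<bar> \<le> e / 4" for n
      by (rule tail) (use w(1) sums_summable[OF w(2)] sums_unique[OF w(2)] in auto)
    have l_tail: "\<bar>(\<Sum>m. l m * a m) - (\<Sum>m<M. l m * a m)\<bar> \<le> e / 4"
      by (rule tail[OF l0 sl l1])
    have "norm ((\<Sum>m. w n m * a m) - (\<Sum>m. l m * a m)) < e" if "n \<ge> N" for n
      using N[OF that] w_tail[of n] l_tail \<open>0 < e\<close> unfolding real_norm_def by linarith
    then show "\<exists>N. \<forall>n\<ge>N. norm ((\<Sum>m. w n m * a m) - (\<Sum>m. l m * a m)) < e" by blast
  qed
qed

text \<open>
  On the countably many functionals \<open>d i\<close>, a point of the closure of the convex hull is approached by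
  a sequence of convex combinations whose weights converge coordinatewise to some \<open>l\<close>. The mass
  \<open>1 - suminf l\<close> that escapes to infinity contributes the limit values \<open>\<zeta>\<close>; the mass that stays
  contributes an honest norm convergent series.
\<close>

lemma pointwise_closure_convex_hull:
  fixes x :: "nat \<Rightarrow> 'a::banach" and d :: "nat \<Rightarrow> ('a \<Rightarrow>\<^sub>L real)"
  assumes bdd: "bounded (range x)"
    and lim: "\<And>i. (\<lambda>n. blinfun_apply (d i) (x n)) \<longlonglongrightarrow> \<zeta> i"
    and y: "\<And>n e. 0 < e \<Longrightarrow> \<exists>s\<in>convex hull (range x).
      \<forall>i\<le>n. \<bar>blinfun_apply (d i) s - blinfun_apply (d i) y\<bar> < (e::real)"
  obtains l where "\<And>m. 0 \<le> l m" "summable l" "suminf l \<le> 1" "summable (\<lambda>m. l m *\<^sub>R x m)"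
    "\<And>i. blinfun_apply (d i) y = blinfun_apply (d i) (\<Sum>m. l m *\<^sub>R x m) + (1 - suminf l) * \<zeta> i"
proof -
  have "\<exists>w. (\<forall>m. 0 \<le> w m) \<and> w sums 1 \<and> (\<forall>i\<le>n. \<exists>t. (\<lambda>m. w m * blinfun_apply (d i) (x m)) sums t \<and>
      \<bar>t - blinfun_apply (d i) y\<bar> < 1 / Suc n)" for n
  proof -
    obtain s where s: "s \<in> convex hull (range x)"
      "\<And>i. i \<le> n \<Longrightarrow> \<bar>blinfun_apply (d i) s - blinfun_apply (d i) y\<bar> < 1 / Suc n"
      using y[of "1 / Suc n" n] by auto
    obtain w where w: "\<And>m. 0 \<le> w m" "w sums 1" "(\<lambda>m. w m *\<^sub>R x m) sums s"
      using convex_hull_range_weights[OF s(1)] by blast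
    have "(\<lambda>m. w m * blinfun_apply (d i) (x m)) sums blinfun_apply (d i) s" for i
      using bounded_linear.sums[OF blinfun.bounded_linear_right w(3), of "d i"]
      by (simp add: blinfun.scaleR_right)
    with w(1,2) s(2) show ?thesis by blast
  qed
  then obtain w where w: "\<And>n m. 0 \<le> w n m" "\<And>n. w n sums 1"
    and w_d: "\<And>n i. i \<le> n \<Longrightarrow> \<exists>t. (\<lambda>m. w n m * blinfun_apply (d i) (x m)) sums t \<and>
      \<bar>t - blinfun_apply (d i) y\<bar> < 1 / Suc n"
    by metis
  have w_le: "w n m \<le> 1" for n m
    using sum_le_suminf[OF sums_summable[OF w(2)], of "{m}" n] sums_unique[OF w(2), of n] w(1) by simp
  define P where "P m s \<longleftrightarrow> convergent (\<lambda>n. w (s n) m)" for m and s :: "nat \<Rightarrow> nat"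
  obtain \<sigma> :: "nat \<Rightarrow> nat" where \<sigma>: "strict_mono \<sigma>" "\<And>m. \<exists>k. P m (\<sigma> \<circ> (+) k)"
  proof (rule diagonal_subsequence[of P])
    fix m and s :: "nat \<Rightarrow> nat"
    have "bounded (range (\<lambda>n. w (s n) m))"
      using w(1) w_le by (intro boundedI[of _ 1]) auto
    then obtain t r where "strict_mono (r :: nat \<Rightarrow> nat)" "((\<lambda>n. w (s n) m) \<circ> r) \<longlonglongrightarrow> t"
      using bounded_imp_convergent_subsequence by metis
    then show "\<exists>r. strict_mono r \<and> P m (s \<circ> r)"
      unfolding P_def convergent_def by (auto simp: o_def)
  next
    fix r :: "nat \<Rightarrow> nat" and s m assume "strict_mono r" "P m s"
    then show "P m (s \<circ> r)"
      unfolding P_def using convergent_subseq_convergent[of "\<lambda>n. w (s n) m" r] by (simp add: o_def)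
  qed blast
  have "\<exists>t. (\<lambda>n. w (\<sigma> n) m) \<longlonglongrightarrow> t" for m
  proof -
    obtain k t where "(\<lambda>n. w (\<sigma> (n + k)) m) \<longlonglongrightarrow> t"
      using \<sigma>(2)[of m] unfolding P_def convergent_def by (auto simp: o_def add.commute)
    then show ?thesis using LIMSEQ_offset[of "\<lambda>n. w (\<sigma> n) m" k] by blast
  qed
  then obtain l where l: "\<And>m. (\<lambda>n. w (\<sigma> n) m) \<longlonglongrightarrow> l m" by metis
  note wl = weighted_limit[of "\<lambda>n. w (\<sigma> n)", OF w l]
  obtain K where K: "\<And>n. norm (x n) \<le> K" using bdd unfolding bounded_iff by auto
  have sum_x: "summable (\<lambda>m. l m *\<^sub>R x m)"
  proof (rule summable_comparison_test')
    show "summable (\<lambda>m. l m * K)" by (rule summable_mult2[OF wl(2)])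
    show "norm (l m *\<^sub>R x m) \<le> l m * K" if "m \<ge> 0" for m
      using mult_left_mono[OF K wl(1)] wl(1) by simp
  qed
  have "blinfun_apply (d i) y = blinfun_apply (d i) (\<Sum>m. l m *\<^sub>R x m) + (1 - suminf l) * \<zeta> i" for i
  proof -
    let ?a = "\<lambda>m. blinfun_apply (d i) (x m) - \<zeta> i"
    have "(\<lambda>n. \<Sum>m. w (\<sigma> n) m * ?a m) \<longlonglongrightarrow> (\<Sum>m. l m * ?a m)"
      by (rule wl(4)) (use lim[of i] in \<open>simp add: LIM_zero\<close>)
    moreover have "(\<lambda>n. \<Sum>m. w (\<sigma> n) m * ?a m) \<longlonglongrightarrow> blinfun_apply (d i) y - \<zeta> i"
    proof (rule LIM_zero_cancel, rule Lim_null_comparison[OF _ LIMSEQ_Suc[OF lim_1_over_n]])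
      have "norm ((\<Sum>m. w (\<sigma> n) m * ?a m) - (blinfun_apply (d i) y - \<zeta> i)) \<le> 1 / Suc n"
        if n: "n \<ge> i" for n
      proof -
        have "i \<le> \<sigma> n" "n \<le> \<sigma> n" using seq_suble[OF \<sigma>(1), of n] n by auto
        then obtain t where t: "(\<lambda>m. w (\<sigma> n) m * blinfun_apply (d i) (x m)) sums t"
          "\<bar>t - blinfun_apply (d i) y\<bar> < 1 / Suc (\<sigma> n)" using w_d by blast
        have "(\<Sum>m. w (\<sigma> n) m * ?a m) = t - \<zeta> i"
          using sums_diff[OF t(1) sums_mult2[OF w(2)[of "\<sigma> n"], of "\<zeta> i"]]
          by (intro sums_unique[symmetric]) (simp add: right_diff_distrib)
        moreover have "1 / real (Suc (\<sigma> n)) \<le> 1 / real (Suc n)"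
          using \<open>n \<le> \<sigma> n\<close> by (intro divide_left_mono) auto
        ultimately show ?thesis using t(2) by simp
      qed
      then show "\<forall>\<^sub>F n in sequentially.
          norm ((\<Sum>m. w (\<sigma> n) m * ?a m) - (blinfun_apply (d i) y - \<zeta> i)) \<le> 1 / real (Suc n)"
        unfolding eventually_sequentially by blast
    qed
    ultimately have "blinfun_apply (d i) y - \<zeta> i = (\<Sum>m. l m * ?a m)"
      using LIMSEQ_unique by blast
    moreover have "(\<lambda>m. l m * blinfun_apply (d i) (x m)) sums blinfun_apply (d i) (\<Sum>m. l m *\<^sub>R x m)"
      using bounded_linear.sums[OF blinfun.bounded_linear_right summable_sums[OF sum_x], of "d i"]
      by (simp add: blinfun.scaleR_right)
    from sums_diff[OF this sums_mult2[OF summable_sums[OF wl(2)], of "\<zeta> i"]]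
    have "(\<Sum>m. l m * ?a m) = blinfun_apply (d i) (\<Sum>m. l m *\<^sub>R x m) - suminf l * \<zeta> i"
      by (intro sums_unique[symmetric]) (simp add: right_diff_distrib)
    ultimately show ?thesis by (simp add: left_diff_distrib)
  qed
  with wl(1-3) sum_x show ?thesis using that by blast
qed

lemma rational_combinations_dense:
  fixes x :: "nat \<Rightarrow> 'a::real_normed_vector"
  shows "(\<Sum>k<K. c k *\<^sub>R x k) \<in>
    closure (range (\<lambda>l :: rat list. \<Sum>k<length l. real_of_rat (l ! k) *\<^sub>R x k))"
proof -
  have "\<exists>q. (\<lambda>n. real_of_rat (q n)) \<longlonglongrightarrow> c k" for k
  proof -
    have "c k \<in> closure \<rat>" by (simp add: Rats_closure_real)
    then obtain q where q: "\<And>n. q n \<in> \<rat>" "q \<longlonglongrightarrow> c k" unfolding closure_sequential by blast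
    have "\<exists>p. q n = real_of_rat p" for n using q(1)[of n] by (rule Rats_cases) auto
    then obtain p where "\<And>n. q n = real_of_rat (p n)" by metis
    then have "q = (\<lambda>n. real_of_rat (p n))" by auto
    with q(2) show ?thesis by auto
  qed
  then obtain q where q: "\<And>k. (\<lambda>n. real_of_rat (q k n)) \<longlonglongrightarrow> c k" by metis
  have "(\<lambda>n. \<Sum>k<K. real_of_rat (q k n) *\<^sub>R x k) \<longlonglongrightarrow> (\<Sum>k<K. c k *\<^sub>R x k)"
    by (intro tendsto_intros q)
  moreover have "(\<Sum>k<K. real_of_rat (q k n) *\<^sub>R x k) \<in>
      range (\<lambda>l :: rat list. \<Sum>k<length l. real_of_rat (l ! k) *\<^sub>R x k)" for n
    by (rule range_eqI[of _ _ "map (\<lambda>k. q k n) [0..<K]"]) (auto intro!: sum.cong)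
  ultimately show ?thesis unfolding closure_sequential
    by (intro exI[of _ "\<lambda>n. \<Sum>k<K. real_of_rat (q k n) *\<^sub>R x k"]) simp
qed

text \<open>
  The coefficients of a subsequence are spread out over the whole sequence, with zeros in between,
  so that the rational combinations of the initial segments of \<open>x\<close> suffice.
\<close>

lemma subsequence_combination_mem_closure:
  fixes x :: "nat \<Rightarrow> 'a::real_normed_vector" and \<tau> :: "nat \<Rightarrow> nat"
  assumes "strict_mono \<tau>" "(\<lambda>m. l m *\<^sub>R x (\<tau> m)) sums q"
  shows "q \<in> closure (range (\<lambda>l :: rat list. \<Sum>k<length l. real_of_rat (l ! k) *\<^sub>R x k))"
    (is "_ \<in> ?R")
proof (rule Lim_in_closed_set)
  have inj: "inj \<tau>" using assms(1) by (rule strict_mono_imp_inj_on)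
  show "\<forall>\<^sub>F N in sequentially. (\<Sum>m<N. l m *\<^sub>R x (\<tau> m)) \<in> ?R"
  proof (rule always_eventually, rule allI)
    fix N
    define c where "c k = (if k \<in> \<tau> ` {..<N} then l (inv \<tau> k) else 0)" for k
    have "(\<Sum>m<N. l m *\<^sub>R x (\<tau> m)) = (\<Sum>k\<in>\<tau> ` {..<N}. c k *\<^sub>R x k)"
      by (subst sum.reindex) (auto simp: c_def inj inj_on_subset[OF inj] intro!: sum.cong)
    also have "\<dots> = (\<Sum>k<\<tau> N. c k *\<^sub>R x k)"
      by (rule sum.mono_neutral_left) (use assms(1) in \<open>auto simp: c_def strict_mono_less\<close>)
    finally show "(\<Sum>m<N. l m *\<^sub>R x (\<tau> m)) \<in> ?R" by (simp only: rational_combinations_dense)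
  qed
  show "(\<lambda>N. \<Sum>m<N. l m *\<^sub>R x (\<tau> m)) \<longlonglongrightarrow> q" using assms(2) unfolding sums_def .
qed auto

section \<open>Quantitative weak compactness from a separable boundary\<close>

text \<open>
  Suppose that \<open>z\<close> has distance more than \<open>r > 2 * \<epsilon>\<close> from the space. The sequence, the functionals
  and the subsequence are chosen so that the point \<open>p\<close> provided by the hypothesis is at distance at
  least \<open>r - \<epsilon> > \<epsilon>\<close> from every \<open>v j\<close>. But \<open>p\<close> is within \<open>\<epsilon>\<close> of a point \<open>y\<close> of the closed
  convex hull, and the dichotomy for \<open>y\<close> puts \<open>p\<close> within \<open>\<epsilon>\<close> of the closure of the \<open>v j\<close>.
\<close>

lemma infdist_bidual_le:
  fixes B :: "('a::banach \<Rightarrow>\<^sub>L real) set"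
  assumes B: "is_boundary B" and A: "bounded A" and "0 \<le> \<epsilon>"
    and D: "countable D" "D \<subseteq> B" "B \<subseteq> weak_star_topology closure_of D"
    and H: "\<And>x :: nat \<Rightarrow> 'a. range x \<subseteq> A \<Longrightarrow> \<exists>p. \<forall>k\<ge>1. \<exists>y u.
        p = y + \<epsilon> *\<^sub>R u \<and> norm u \<le> 1 \<and> y \<in> sigma_topology B closure_of (convex hull (x ` {k..}))"
    and z: "z \<in> weak_star_topology closure_of (bidual_embedding ` A)"
  shows "infdist z (range bidual_embedding) \<le> 2 * \<epsilon>"
proof (rule ccontr)
  assume "\<not> ?thesis"
  \<comment> \<open>The functionals give separation \<open>s\<close>; passing to members of \<open>B\<close> lowers it to \<open>r\<close>.\<close>
  then obtain s where s: "2 * \<epsilon> < s" "s < infdist z (range bidual_embedding)"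
    using dense not_le by metis
  then obtain r where r: "2 * \<epsilon> < r" "r < s" using dense by metis
  have "B \<noteq> {}" using B unfolding is_boundary_def by blast
  then have "D \<noteq> {}" using D(3) by (metis closure_of_empty subset_empty)
  define d where "d = from_nat_into D"
  have range_d: "range d = D" using range_from_nat_into[OF \<open>D \<noteq> {}\<close> D(1)] by (simp add: d_def)
  have d_B: "d i \<in> B" for i using range_d D(2) by auto
  have norm_le: "norm v \<le> t" if "\<And>i. blinfun_apply (d i) v \<le> t" for v t
    by (rule norm_le_if_dense[OF B D(3)]) (use that range_d in auto)
  note B_le = boundary_apply_le_norm[OF B]
  \<comment> \<open>If some vector agrees with \<open>z\<close> on \<open>D\<close> then \<open>y0\<close> is that vector; otherwise \<open>y0\<close> is arbitrary.\<close>
  obtain y0 where y0: "\<And>y. (\<And>i. blinfun_apply (d i) y = blinfun_apply z (d i)) \<Longrightarrow>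
      (\<forall>i. blinfun_apply (d i) y0 = blinfun_apply z (d i))" by metis
  have "\<exists>f. norm f \<le> 1 \<and> s < blinfun_apply z f - blinfun_apply f v" for v
  proof -
    have "0 \<le> s" using s(1) \<open>0 \<le> \<epsilon>\<close> by linarith
    from norming_functional_far[OF this s(2), of v] show ?thesis by blast
  qed
  then obtain F where F: "\<And>v. norm (F v) \<le> 1" "\<And>v. s < blinfun_apply z (F v) - blinfun_apply (F v) v"
    by metis
  \<comment> \<open>The vectors to be kept away from: \<open>y0\<close> and every rational combination of the sequence. The cut-off
    \<open>k < j\<close> makes the \<open>j\<close>-th of them depend on the first \<open>j\<close> terms only; coding the length of \<open>l\<close>
    into \<open>j\<close> ensures that every list also occurs at an index where nothing is cut off.\<close>
  define V where "V x j = (case j of 0 \<Rightarrow> y0 | Suc i \<Rightarrow> let l = from_nat (fst (prod_decode i)) :: rat list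
      in \<Sum>k<length l. if k < j then real_of_rat (l ! k) *\<^sub>R x k else 0)" for x :: "nat \<Rightarrow> 'a" and j
  have V_local: "V x j = V x' j" if "\<And>i. i < j \<Longrightarrow> x i = x' i" for x x' j
    using that by (auto simp: V_def Let_def split: nat.splits intro!: sum.cong)
  have V_comb: "(\<Sum>k<length l. real_of_rat (l ! k) *\<^sub>R x k) \<in> range (V x)" for x and l :: "rat list"
  proof (rule range_eqI[of _ _ "Suc (prod_encode (to_nat l, length l))"])
    have "length l \<le> prod_encode (to_nat l, length l)" by (rule le_prod_encode_2)
    then show "(\<Sum>k<length l. real_of_rat (l ! k) *\<^sub>R x k) = V x (Suc (prod_encode (to_nat l, length l)))"
      by (auto simp: V_def intro!: sum.cong)
  qed
  define G where "G x n = (if even n then d (n div 2) else F (V x (n div 2)))" for x n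
  obtain x where x: "range x \<subseteq> A"
    and x_G: "\<And>n. (\<lambda>m. blinfun_apply (G x n) (x m)) \<longlonglongrightarrow> blinfun_apply z (G x n)"
  proof (rule adapted_sequence[OF z, of G])
    fix x x' :: "nat \<Rightarrow> 'a" and n assume "\<And>i. i < n \<Longrightarrow> x i = x' i"
    then have "V x (n div 2) = V x' (n div 2)" by (intro V_local) auto
    then show "G x n = G x' n" by (simp add: G_def)
  qed blast
  define v where "v = V x"
  have x_d: "(\<lambda>m. blinfun_apply (d i) (x m)) \<longlonglongrightarrow> blinfun_apply z (d i)" for i
    using x_G[of "2 * i"] by (simp add: G_def)
  have x_F: "(\<lambda>m. blinfun_apply (F (v j)) (x m)) \<longlonglongrightarrow> blinfun_apply z (F (v j))" for j
    using x_G[of "2 * j + 1"] by (simp add: G_def v_def)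
  have bdd_x: "bounded (range x)" using A x by (rule bounded_subset)
  \<comment> \<open>Each \<open>v j\<close> receives a single member of \<open>B\<close> witnessing, along the whole of a tail of one common
    subsequence, that the terms stay more than \<open>r\<close> away from \<open>v j\<close>.\<close>
  define P where "P j \<sigma> \<longleftrightarrow> (\<exists>b\<in>B. \<forall>n. r < blinfun_apply b (x (\<sigma> n) - v j))" for j and \<sigma> :: "nat \<Rightarrow> nat"
  obtain \<sigma> :: "nat \<Rightarrow> nat" where \<sigma>: "strict_mono \<sigma>" "\<And>j. \<exists>k. P j (\<sigma> \<circ> (+) k)"
  proof (rule diagonal_subsequence[of P])
    fix j and \<sigma> :: "nat \<Rightarrow> nat" assume \<sigma>: "strict_mono \<sigma>"
    have "(\<lambda>n. blinfun_apply (F (v j)) (x (\<sigma> n))) \<longlonglongrightarrow> blinfun_apply z (F (v j))"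
      using LIMSEQ_subseq_LIMSEQ[OF x_F \<sigma>] by (simp add: o_def)
    then have "(\<lambda>n. blinfun_apply (F (v j)) (x (\<sigma> n) - v j))
        \<longlonglongrightarrow> blinfun_apply z (F (v j)) - blinfun_apply (F (v j)) (v j)"
      by (simp add: blinfun.diff_right tendsto_diff)
    from order_tendstoD(1)[OF this F(2)] obtain N where
      N: "\<And>n. n \<ge> N \<Longrightarrow> s < blinfun_apply (F (v j)) (x (\<sigma> n) - v j)"
      unfolding eventually_sequentially by blast
    have "bounded (range (\<lambda>n. x (\<sigma> (n + N)) - v j))"
      by (rule bounded_subset[OF bounded_minus[OF bdd_x, of "{v j}"]]) auto
    then obtain b and \<rho> :: "nat \<Rightarrow> nat" where b: "b \<in> B" "strict_mono \<rho>"
      "\<And>n. r < blinfun_apply b (x (\<sigma> (\<rho> n + N)) - v j)"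
      by (rule simons_subsequence[OF B _ F(1)[of "v j"] less_imp_le[OF N] r(2)]) auto
    have "strict_mono (\<lambda>n. \<rho> n + N)" using b(2) by (simp add: strict_mono_def)
    moreover have "P j (\<sigma> \<circ> (\<lambda>n. \<rho> n + N))" using b(1,3) unfolding P_def by auto
    ultimately show "\<exists>\<rho>. strict_mono \<rho> \<and> P j (\<sigma> \<circ> \<rho>)" by blast
  next
    fix \<rho> \<sigma> :: "nat \<Rightarrow> nat" and j assume "strict_mono \<rho>" "P j \<sigma>"
    then show "P j (\<sigma> \<circ> \<rho>)" unfolding P_def by auto
  qed blast
  define t where "t = x \<circ> \<sigma>"
  have "range t \<subseteq> A" using x by (auto simp: t_def)
  then obtain p where p: "\<And>k. k \<ge> 1 \<Longrightarrow> \<exists>y u. p = y + \<epsilon> *\<^sub>R u \<and> norm u \<le> 1 \<and>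
      y \<in> sigma_topology B closure_of (convex hull (t ` {k..}))" using H by blast
  \<comment> \<open>Bounds on the terms carry over to \<open>p\<close> with loss \<open>\<epsilon>\<close>. The case \<open>- b \<in> B\<close> gives the upper bounds.\<close>
  have p_ge: "c - \<epsilon> \<le> blinfun_apply b p"
    if b: "b \<in> B \<or> - b \<in> B" and c: "\<And>n. n \<ge> k \<Longrightarrow> c \<le> blinfun_apply b (t n)" for b c k
  proof -
    obtain y u where yu: "p = y + \<epsilon> *\<^sub>R u" "norm u \<le> 1"
      "y \<in> sigma_topology B closure_of (convex hull (t ` {max 1 k..}))" using p[of "max 1 k"] by auto
    have hull: "convex hull (t ` {max 1 k..}) \<subseteq> {w. c \<le> blinfun_apply b w}"
      by (intro hull_minimal convex_functional_halfspace) (use c in auto)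
    have "c \<le> blinfun_apply b y"
    proof (rule field_le_epsilon)
      fix e :: real assume "0 < e"
      define b' where "b' = (if b \<in> B then b else - b)"
      have "b' \<in> B" using b by (auto simp: b'_def)
      obtain w where w: "w \<in> convex hull (t ` {max 1 k..})" "\<bar>blinfun_apply b' w - blinfun_apply b' y\<bar> < e"
        by (rule sigma_closure_approx[OF yu(3), of "{b'}" e]) (use \<open>b' \<in> B\<close> \<open>0 < e\<close> in auto)
      then show "c \<le> blinfun_apply b y + e"
        using hull by (auto simp: b'_def blinfun.minus_left split: if_splits)
    qed
    moreover have "\<bar>blinfun_apply b u\<bar> \<le> 1"
      using b B_le[of b u] B_le[of "- b" u] yu(2) by (auto simp: blinfun.minus_left)
    then have "\<bar>\<epsilon> * blinfun_apply b u\<bar> \<le> \<epsilon>" using \<open>0 \<le> \<epsilon>\<close> by (simp add: abs_mult mult_left_le)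
    ultimately show ?thesis unfolding yu(1) by (simp add: blinfun.add_right blinfun.scaleR_right)
  qed
  have far: "r - \<epsilon> \<le> norm (p - v j)" for j
  proof -
    obtain k b where b: "b \<in> B" "\<And>n. r < blinfun_apply b (x (\<sigma> (k + n)) - v j)"
      using \<sigma>(2)[of j] unfolding P_def by auto
    have "r + blinfun_apply b (v j) \<le> blinfun_apply b (t n)" if "n \<ge> k" for n
      using b(2)[of "n - k"] that by (simp add: t_def blinfun.diff_right)
    then have "r + blinfun_apply b (v j) - \<epsilon> \<le> blinfun_apply b p" using p_ge b(1) by blast
    then show ?thesis using B_le[OF b(1), of "p - v j"] by (simp add: blinfun.diff_right)
  qed
  have t_d: "(\<lambda>n. blinfun_apply (d i) (t n)) \<longlonglongrightarrow> blinfun_apply z (d i)" for i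
    using LIMSEQ_subseq_LIMSEQ[OF x_d \<sigma>(1)] by (simp add: o_def t_def)
  have p_d: "blinfun_apply (d i) p \<le> blinfun_apply z (d i) + \<epsilon>" for i
  proof (rule field_le_epsilon)
    fix e :: real assume "0 < e"
    then have "blinfun_apply z (d i) < blinfun_apply z (d i) + e" by simp
    from order_tendstoD(2)[OF t_d this] obtain k where
      k: "\<And>n. n \<ge> k \<Longrightarrow> blinfun_apply (d i) (t n) < blinfun_apply z (d i) + e"
      unfolding eventually_sequentially by blast
    have "- (blinfun_apply z (d i) + e) - \<epsilon> \<le> blinfun_apply (- d i) p"
    proof (rule p_ge[of _ k])
      show "- (blinfun_apply z (d i) + e) \<le> blinfun_apply (- d i) (t n)" if "n \<ge> k" for n
        using k[OF that] by (simp add: blinfun.minus_left)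
    qed (simp add: d_B)
    then show "blinfun_apply (d i) p \<le> blinfun_apply z (d i) + \<epsilon> + e" by (simp add: blinfun.minus_left)
  qed
  obtain y u where yu: "p = y + \<epsilon> *\<^sub>R u" "norm u \<le> 1"
    "y \<in> sigma_topology B closure_of (convex hull (t ` {1..}))" using p[of 1] by auto
  define x' where "x' n = x (\<sigma> (Suc n))" for n
  have range_x': "t ` {1..} = range x'"
  proof -
    have "{1..} = range Suc" by (auto simp: image_iff Suc_le_eq gr0_conv_Suc)
    then show ?thesis by (simp add: t_def x'_def image_image)
  qed
  obtain l where l: "\<And>m. 0 \<le> l m" "summable l" "suminf l \<le> 1" "summable (\<lambda>m. l m *\<^sub>R x' m)"
    "\<And>i. blinfun_apply (d i) y = blinfun_apply (d i) (\<Sum>m. l m *\<^sub>R x' m) + (1 - suminf l) * blinfun_apply z (d i)"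
  proof (rule pointwise_closure_convex_hull[of x' d])
    show "bounded (range x')" by (rule bounded_subset[OF bdd_x]) (auto simp: x'_def)
    show "(\<lambda>n. blinfun_apply (d i) (x' n)) \<longlonglongrightarrow> blinfun_apply z (d i)" for i
      using LIMSEQ_Suc[OF t_d] by (simp add: t_def x'_def)
    show "\<exists>w\<in>convex hull (range x'). \<forall>i\<le>n. \<bar>blinfun_apply (d i) w - blinfun_apply (d i) y\<bar> < e"
      if "0 < e" for n and e :: real
    proof -
      obtain w where "w \<in> convex hull (range x')"
        "\<And>b. b \<in> d ` {..n} \<Longrightarrow> \<bar>blinfun_apply b w - blinfun_apply b y\<bar> < e"
        by (rule sigma_closure_approx[OF yu(3), of "d ` {..n}" e, unfolded range_x']) (use d_B \<open>0 < e\<close> in auto)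
      then show ?thesis by auto
    qed
  qed blast
  define q where "q = (\<Sum>m. l m *\<^sub>R x' m)"
  show False
  proof (cases "suminf l = 1")
    \<comment> \<open>All the weight stays on finite indices: \<open>y\<close> lies in the closed span of the sequence.\<close>
    case True
    have "norm (y - q) \<le> 0"
      by (rule norm_le) (simp add: l(5) True blinfun.diff_right q_def)
    then have "y = q" by simp
    have "strict_mono (\<lambda>n. \<sigma> (Suc n))" using \<sigma>(1) by (simp add: strict_mono_def)
    moreover have "(\<lambda>m. l m *\<^sub>R x (\<sigma> (Suc m))) sums q"
      using summable_sums[OF l(4)] by (simp add: q_def x'_def)
    ultimately have "q \<in> closure (range (\<lambda>l :: rat list. \<Sum>k<length l. real_of_rat (l ! k) *\<^sub>R x k))"
      by (rule subsequence_combination_mem_closure)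
    moreover have "range (\<lambda>l :: rat list. \<Sum>k<length l. real_of_rat (l ! k) *\<^sub>R x k) \<subseteq> range v"
      using V_comb by (auto simp: v_def)
    ultimately have "q \<in> closure (range v)" using closure_mono by blast
    moreover have "0 < r - 2 * \<epsilon>" using r(1) by simp
    ultimately obtain j where "dist (v j) q < r - 2 * \<epsilon>" unfolding closure_approachable by blast
    moreover have "norm (p - v j) \<le> \<epsilon> + dist (v j) q"
    proof -
      have "norm (p - v j) = norm (\<epsilon> *\<^sub>R u + (q - v j))"
        by (simp add: yu(1) \<open>y = q\<close> algebra_simps)
      also have "\<dots> \<le> norm (\<epsilon> *\<^sub>R u) + norm (q - v j)" by (rule norm_triangle_ineq)
      also have "norm (\<epsilon> *\<^sub>R u) \<le> \<epsilon>" using \<open>0 \<le> \<epsilon>\<close> yu(2) by (simp add: mult_left_le)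
      finally show ?thesis by (simp add: dist_norm norm_minus_commute)
    qed
    ultimately show False using far[of j] by linarith
  next
    \<comment> \<open>Some weight escapes to infinity, and what remains of \<open>y\<close> is a multiple of a copy of \<open>z\<close> on \<open>D\<close>.\<close>
    case False
    define y' where "y' = (1 / (1 - suminf l)) *\<^sub>R (y - q)"
    have "blinfun_apply (d i) y' = blinfun_apply z (d i)" for i
      using False by (simp add: y'_def l(5) q_def blinfun.diff_right blinfun.scaleR_right)
    then have y0_d: "blinfun_apply (d i) y0 = blinfun_apply z (d i)" for i using y0 by blast
    have "norm (p - y0) \<le> \<epsilon>"
      by (rule norm_le) (use p_d y0_d in \<open>simp add: blinfun.diff_right algebra_simps\<close>)
    moreover have "v 0 = y0" by (simp add: v_def V_def)
    ultimately have "norm (p - v 0) \<le> \<epsilon>" by simp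
    then show False using far[of 0] r(1) by linarith
  qed
qed

theorem corollary2p6:
  fixes B :: "('a::banach \<Rightarrow>\<^sub>L real) set" and A :: "'a set" and \<epsilon> :: real
  assumes "is_boundary B" and "bounded A" and "0 \<le> \<epsilon>"
  shows "(separable_space (euclidean :: 'a topology) \<longrightarrow> weak_star_separable B) \<and>
    (weak_star_separable B \<longrightarrow>
      (\<forall>x :: nat \<Rightarrow> 'a. range x \<subseteq> A \<longrightarrow>
        (\<Inter>k\<in>{1..}. {y + \<epsilon> *\<^sub>R u | y u.
            y \<in> sigma_topology B closure_of (convex hull {x n | n. n \<ge> k}) \<and> u \<in> cball 0 1}) \<noteq> {}) \<longrightarrow>
      delta_WRC (2 * \<epsilon>) A)"
proof (intro conjI impI)
  have "bounded B"
    using assms(1) unfolding is_boundary_def by (intro boundedI[of _ 1]) auto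
  then show "weak_star_separable B" if "separable_space (euclidean :: 'a topology)"
    using that separable_imp_weak_star_separable by blast
  assume "weak_star_separable B"
  then obtain D where D: "countable D" "D \<subseteq> B" "B \<subseteq> weak_star_topology closure_of D"
    unfolding weak_star_separable_def separable_space_def
    by (auto simp: closure_of_subtopology strong_operator_topology_topspace Int_absorb1)
  assume H: "\<forall>x :: nat \<Rightarrow> 'a. range x \<subseteq> A \<longrightarrow>
        (\<Inter>k\<in>{1..}. {y + \<epsilon> *\<^sub>R u | y u.
            y \<in> sigma_topology B closure_of (convex hull {x n | n. n \<ge> k}) \<and> u \<in> cball 0 1}) \<noteq> {}"
  have "\<exists>p. \<forall>k\<ge>1. \<exists>y u. p = y + \<epsilon> *\<^sub>R u \<and> norm u \<le> 1 \<and>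
      y \<in> sigma_topology B closure_of (convex hull (x ` {k..}))" if "range x \<subseteq> A" for x :: "nat \<Rightarrow> 'a"
  proof -
    have tail: "{x n | n. n \<ge> k} = x ` {k..}" for k by auto
    define S where "S k = {y + \<epsilon> *\<^sub>R u | y u.
        y \<in> sigma_topology B closure_of (convex hull (x ` {k..})) \<and> u \<in> cball 0 1}" for k
    have "(\<Inter>k\<in>{1..}. S k) \<noteq> {}" using H[rule_format, OF that] unfolding tail S_def .
    then obtain p where p: "p \<in> (\<Inter>k\<in>{1..}. S k)" by (meson equals0I)
    have "\<exists>y u. p = y + \<epsilon> *\<^sub>R u \<and> norm u \<le> 1 \<and>
        y \<in> sigma_topology B closure_of (convex hull (x ` {k..}))" if "k \<ge> 1" for k
    proof -
      have "p \<in> S k" using p that by auto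
      then show ?thesis unfolding S_def by auto
    qed
    then show ?thesis by (intro exI[of _ p]) simp
  qed
  then show "delta_WRC (2 * \<epsilon>) A"
    unfolding delta_WRC_def by (intro conjI ballI assms(2) infdist_bidual_le[OF assms D])
qed

end
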